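(* Let $\mathcal{Q}\subseteq\mathbb{R}^d$ be a nonempty closed convex set with nonempty interior, and consider $\min_{x\in\mathcal{Q}}F(x)$, $F=\sum_{n=1}^N f_n$, $N\ge 2$, with optimal value $F^*$ and with nonempty compact set of minimizers $\mathcal{X}$. Suppose each $f_n:\mathbb{R}^d\to\mathbb{R}$ is convex and differentiable with $\|\nabla f_n(x)-\nabla f_n(y)\|\le L_n\|x-y\|$ for all $x,y\in\mathbb{R}^d$, where $L_n>0$. Let $\{x_k\}$ be generated by the constrained incremental aggregated proximal (IAP) method with constant step size $\alpha>0$, $$x_{k+1}=\arg\min_{x\in\mathcal{Q}}\Big\{f_{i_k}(x)+\Big\langle\sum_{j\ne i_k}\nabla f_j(x_{k-\tau_k^j}),x\Big\rangle+\frac{1}{2\alpha}\|x-x_k\|^2\Big\},\qquad k\ge 0,$$ where $x_0\in\mathbb{R}^d$, $x_k=x_0$ for $k<0$, $i_k\in\{1,\dots,N\}$ is arbitrary, and the delays $\tau_k^n$ are integers with smallest upper bound $\tau$, i.e. $\tau_k^n\in\{0,\dots,\tau\}$. Let $L:=\max_{k\ge 0}\sum_{j\ne i_k}L_j$. (1) The method converges globally sublinearly: if $0<\alpha\le\frac{2}{L(\tau+1)^2(\tau+2)}$, then $$F(x_k)-F^*\le\frac{1}{2\alpha k}\|x^*-x_0\|^2,\qquad\forall k\ge 1,\ x^*\in\mathcal{X}.$$ (2) If, in addition, there is $\nu>0$ such that $F(x)-F^*\ge\frac{\nu}{2}d^2(x,\mathcal{X})$ for all $x\in\mathcal{Q}$,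 then the method converges globally linearly: if $0<\alpha\le\frac{1}{\nu}\Big[\big(1+\frac{\nu}{L(\tau+1)}\big)^{\frac{1}{\tau+1}}-1\Big]$, then, with $\Gamma_\alpha(x):=F(x)+\delta_{\mathcal{Q}}(x)-F^*+\frac{1}{2\alpha}d^2(x,\mathcal{X})$, $$\Gamma_\alpha(x_k)\le\left(\frac{1}{1+\alpha\nu}\right)^k\Gamma_\alpha(x_0),\qquad\forall k\ge 0.$$
   Context: $d(x,\mathcal{X})=\inf_{y\in\mathcal{X}}\|x-y\|$ is the Euclidean distance, and $\delta_{\mathcal{Q}}$ is the indicator function of $\mathcal{Q}$ ($0$ on $\mathcal{Q}$, $+\infty$ elsewhere). *)

theory Defs
  imports "HOL-Analysis.Analysis"
begin

definition obj_sum :: "nat \<Rightarrow> (nat \<Rightarrow> real ^ 'd \<Rightarrow> real) \<Rightarrow> real ^ 'd \<Rightarrow> real" where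
  "obj_sum N f x = (\<Sum>n=1..N. f n x)"

definition minimizers :: "('a \<Rightarrow> real) \<Rightarrow> 'a set \<Rightarrow> 'a set" where
  "minimizers F Q = {x. is_arg_min F (\<lambda>z. z \<in> Q) x}"

text \<open>\<open>Inf\<close> on reals is only meaningful for sets that are nonempty and bounded below; this is
  the case whenever \<open>minimizers F Q\<close> is nonempty.\<close>

definition opt_val :: "('a \<Rightarrow> real) \<Rightarrow> 'a set \<Rightarrow> real" where
  "opt_val F Q = (INF x\<in>Q. F x)"

definition ext_indicator :: "'a set \<Rightarrow> 'a \<Rightarrow> ereal" where
  "ext_indicator Q x = (if x \<in> Q then 0 else \<infinity>)"

definition lyapunov ::
    "(real ^ 'd \<Rightarrow> real) \<Rightarrow> (real ^ 'd) set \<Rightarrow> real \<Rightarrow> real ^ 'd \<Rightarrow> ereal" where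
  "lyapunov F Q \<alpha> x =
     ereal (F x) + ext_indicator Q x - ereal (opt_val F Q)
       + ereal (1 / (2 * \<alpha>) * (infdist x (minimizers F Q))\<^sup>2)"

text \<open>\<open>g n\<close> is the gradient of the component \<open>f n\<close>, \<open>i k\<close> the component processed at step \<open>k\<close>,
  and \<open>dl k j\<close> the delay of component \<open>j\<close> at step \<open>k\<close>. The iterates are indexed by integers so
  that delayed indices may be negative. The minimizer in each step is unique when \<open>Q\<close> and the
  \<open>f n\<close> are convex and \<open>\<alpha> > 0\<close>, so stating that the next iterate is a minimizer determines it.\<close>

definition iap_sequence ::
    "nat \<Rightarrow> (nat \<Rightarrow> real ^ 'd \<Rightarrow> real) \<Rightarrow> (nat \<Rightarrow> real ^ 'd \<Rightarrow> real ^ 'd) \<Rightarrow> (real ^ 'd) set \<Rightarrow> real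
      \<Rightarrow> (nat \<Rightarrow> nat) \<Rightarrow> (nat \<Rightarrow> nat \<Rightarrow> nat) \<Rightarrow> (int \<Rightarrow> real ^ 'd) \<Rightarrow> bool" where
  "iap_sequence N f g Q \<alpha> i dl x \<longleftrightarrow>
     (\<forall>k<0. x k = x 0) \<and>
     (\<forall>k::nat. is_arg_min
        (\<lambda>z. f (i k) z
            + (\<Sum>j\<in>{1..N} - {i k}. g j (x (int k - int (dl k j)))) \<bullet> z
            + 1 / (2 * \<alpha>) * (norm (z - x (int k)))\<^sup>2)
        (\<lambda>z. z \<in> Q)
        (x (int k + 1)))"

definition smallest_delay_bound :: "nat \<Rightarrow> (nat \<Rightarrow> nat \<Rightarrow> nat) \<Rightarrow> nat \<Rightarrow> bool" where
  "smallest_delay_bound N dl \<tau> \<longleftrightarrow>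
     (\<forall>k. \<forall>n\<in>{1..N}. dl k n \<le> \<tau>) \<and>
     (\<forall>t. (\<forall>k. \<forall>n\<in>{1..N}. dl k n \<le> t) \<longrightarrow> \<tau> \<le> t)"

text \<open>The maximum over all steps is taken over a finite set of values as long as \<open>i\<close> ranges
  in \<open>{1..N}\<close>.\<close>

definition max_partial_lipschitz :: "nat \<Rightarrow> (nat \<Rightarrow> real) \<Rightarrow> (nat \<Rightarrow> nat) \<Rightarrow> real" where
  "max_partial_lipschitz N Lip i = Max (range (\<lambda>k. \<Sum>j\<in>{1..N} - {i k}. Lip j))"

end

theory Submission
  imports Defs
begin

text \<open>
  Strong convexity of the proximal subproblem, the descent lemma and convexity give, for \<open>z\<close> in \<open>Q\<close>,
  \<open>F(x\<^sub>k\<^sub>+\<^sub>1) \<le> F(z) + (|z - x\<^sub>k|\<^sup>2 - |z - x\<^sub>k\<^sub>+\<^sub>1|\<^sup>2 - D\<^sub>k) / (2\<alpha>) + L(\<tau> + 1)/2 (D\<^sub>k + \<dots> + D\<^sub>k\<^sub>-\<^sub>\<tau>)\<close>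
  where \<open>D\<^sub>k = |x\<^sub>k\<^sub>+\<^sub>1 - x\<^sub>k|\<^sup>2\<close>. For the sublinear rate, the inequality with \<open>z\<close> a minimizer is added to
  \<open>k\<close> times the one with \<open>z = x\<^sub>k\<close>; the weight 0 at \<open>k = 0\<close> is what allows \<open>x\<^sub>0\<close> to lie outside \<open>Q\<close>.
  For the linear rate, \<open>z\<close> is the projection of \<open>x\<^sub>k\<close> onto the minimizers, quadratic growth gives a
  contraction by \<open>1 + \<alpha>\<nu>\<close>, and the inequalities are weighted by powers of that factor. In both cases
  the bound on \<open>\<alpha>\<close> says that the total coefficient of each \<open>D\<^sub>k\<close> is at most 0.
\<close>

section \<open>Convex functions and functions with Lipschitz gradient\<close>

lemma GDERIV_along_line:
  fixes f :: "'a::real_inner \<Rightarrow> real"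
  assumes "GDERIV f (y + t *\<^sub>R w) :> g"
  shows "((\<lambda>t. f (y + t *\<^sub>R w)) has_field_derivative g \<bullet> w) (at t)"
proof -
  have "((\<lambda>t. f (y + t *\<^sub>R w)) has_derivative (\<lambda>s. (s *\<^sub>R w) \<bullet> g)) (at t)"
    using assms unfolding gderiv_def
    by (rule has_derivative_compose[rotated]) (auto intro!: derivative_eq_intros)
  then show ?thesis
    by (rule has_derivative_imp_has_field_derivative) (simp add: inner_commute)
qed

text \<open>Along the line through \<open>y\<close> and \<open>z\<close> the function becomes a
  convex function \<open>h\<close> of one real variable, whose value at 1 lies above the tangent at
  0.\<close>

lemma convex_gradient_inequality:
  fixes f :: "'a::real_inner \<Rightarrow> real"
  assumes "convex_on UNIV f" "GDERIV f y :> g"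
  shows "f z \<ge> f y + g \<bullet> (z - y)"
proof -
  define h where "h = (\<lambda>t::real. f (y + t *\<^sub>R (z - y)))"
  have "convex_on UNIV h"
  proof (rule convex_onI)
    fix t a b :: real assume t: "0 < t" "t < 1"
    have "y + ((1 - t) *\<^sub>R a + t *\<^sub>R b) *\<^sub>R (z - y) =
      (1 - t) *\<^sub>R (y + a *\<^sub>R (z - y)) + t *\<^sub>R (y + b *\<^sub>R (z - y))"
      by (simp add: algebra_simps)
    then show "h ((1 - t) *\<^sub>R a + t *\<^sub>R b) \<le> (1 - t) * h a + t * h b"
      unfolding h_def using convex_onD[OF assms(1), of t] t by simp
  qed simp
  moreover have "(h has_field_derivative g \<bullet> (z - y)) (at 0)"
    using GDERIV_along_line[of f y 0 "z - y" g] assms(2) by (simp add: h_def)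
  ultimately have "h 1 - h 0 \<ge> g \<bullet> (z - y) * (1 - 0)"
    by (intro convex_on_imp_above_tangent[of UNIV]) auto
  then show ?thesis by (simp add: h_def)
qed

text \<open>Up to the constant \<open>f y\<close>, \<open>h\<close> is the difference of the two
  sides along the segment from \<open>y\<close> to \<open>u\<close>. Cauchy-Schwarz and the
  Lipschitz bound make its derivative nonpositive on the unit interval.\<close>

lemma descent_lemma:
  fixes f :: "'a::real_inner \<Rightarrow> real"
  assumes deriv: "\<And>z. GDERIV f z :> g z"
    and lip: "\<And>y z. norm (g y - g z) \<le> C * norm (y - z)"
  shows "f u \<le> f y + g y \<bullet> (u - y) + C / 2 * (norm (u - y))\<^sup>2"
proof -
  define w where "w = u - y"
  define h where "h = (\<lambda>t::real. f (y + t *\<^sub>R w) - t * (g y \<bullet> w) - C / 2 * t\<^sup>2 * (norm w)\<^sup>2)"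
  have "h 1 \<le> h 0"
  proof (rule DERIV_nonpos_imp_nonincreasing[of 0 1 h])
    fix t :: real assume t: "0 \<le> t" "t \<le> 1"
    have "((\<lambda>t. f (y + t *\<^sub>R w)) has_field_derivative g (y + t *\<^sub>R w) \<bullet> w) (at t)"
      by (intro GDERIV_along_line deriv)
    then have D: "(h has_field_derivative
        g (y + t *\<^sub>R w) \<bullet> w - g y \<bullet> w - C * t * (norm w)\<^sup>2) (at t)"
      unfolding h_def by (auto intro!: derivative_eq_intros)
    have "(g (y + t *\<^sub>R w) - g y) \<bullet> w \<le> norm (g (y + t *\<^sub>R w) - g y) * norm w"
      by (rule norm_cauchy_schwarz)
    also have "\<dots> \<le> C * norm (t *\<^sub>R w) * norm w"
      using lip[of "y + t *\<^sub>R w" y] by (intro mult_right_mono) auto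
    also have "\<dots> = C * t * (norm w)\<^sup>2"
      using t by (simp add: power2_eq_square)
    finally show "\<exists>e. DERIV h t :> e \<and> e \<le> 0"
      using D by (auto simp: inner_diff_left)
  qed simp
  then show ?thesis by (simp add: h_def w_def)
qed

section \<open>The proximal step with outdated gradients\<close>

text \<open>The quadratic term makes the objective strongly convex, which sharpens the minimality of
  \<open>u\<close> by the term in \<open>norm (z - u)\<close>. To see this, \<open>u\<close> is
  compared with points of the segment towards \<open>z\<close>; the inequality is divided by the
  parameter \<open>t\<close>, and \<open>t\<close> tends to 0.\<close>

lemma prox_three_point:
  fixes h :: "'a::real_inner \<Rightarrow> real"
  assumes h: "convex_on UNIV h" and Q: "convex Q" and \<alpha>: "\<alpha> > 0" and z: "z \<in> Q"
    and min: "is_arg_min (\<lambda>z. h z + 1 / (2 * \<alpha>) * (norm (z - v))\<^sup>2) (\<lambda>z. z \<in> Q) u"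
  shows "h u + 1 / (2 * \<alpha>) * (norm (u - v))\<^sup>2 + 1 / (2 * \<alpha>) * (norm (z - u))\<^sup>2
    \<le> h z + 1 / (2 * \<alpha>) * (norm (z - v))\<^sup>2"
proof -
  define c where "c = 1 / (2 * \<alpha>)"
  define P where "P = (\<lambda>z. h z + c * (norm (z - v))\<^sup>2)"
  have u: "u \<in> Q" and le: "\<And>w. w \<in> Q \<Longrightarrow> P u \<le> P w"
    using min by (auto simp: is_arg_min_linorder P_def c_def)
  have *: "P u + (1 - t) * (c * (norm (z - u))\<^sup>2) \<le> P z" if t: "0 < t" "t < 1" for t
  proof -
    define w where "w = (1 - t) *\<^sub>R u + t *\<^sub>R z"
    have "w \<in> Q" using convexD[OF Q u z, of "1 - t" t] t by (simp add: w_def)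
    have "h w \<le> (1 - t) * h u + t * h z"
      unfolding w_def using convex_onD[OF h, of t u z] t by simp
    moreover
    \<comment> \<open>This exact identity is the source of strong convexity: its last term is the
      gain over mere convexity.\<close>
    have "(norm (w - v))\<^sup>2 = (1 - t) * (norm (u - v))\<^sup>2 + t * (norm (z - v))\<^sup>2
        - t * (1 - t) * (norm (z - u))\<^sup>2"
      unfolding w_def power2_norm_eq_inner
      by (simp add: inner_diff_left inner_diff_right inner_add_left inner_add_right
          inner_commute algebra_simps)
    then have "c * (norm (w - v))\<^sup>2 = c * ((1 - t) * (norm (u - v))\<^sup>2 + t * (norm (z - v))\<^sup>2
        - t * (1 - t) * (norm (z - u))\<^sup>2)"
      by simp
    ultimately have "P w \<le> (1 - t) * P u + t * P z - t * (1 - t) * (c * (norm (z - u))\<^sup>2)"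
      by (simp add: P_def algebra_simps)
    with le[OF \<open>w \<in> Q\<close>] have "t * (P u + (1 - t) * (c * (norm (z - u))\<^sup>2)) \<le> t * P z"
      by (simp add: algebra_simps)
    then show ?thesis using t by simp
  qed
  have "((\<lambda>t. P u + (1 - t) * (c * (norm (z - u))\<^sup>2)) \<longlongrightarrow> P u + (1 - 0) * (c * (norm (z - u))\<^sup>2))
      (at_right 0)"
    by (intro tendsto_intros)
  moreover have "\<forall>\<^sub>F t in at_right (0::real). P u + (1 - t) * (c * (norm (z - u))\<^sup>2) \<le> P z"
    using * by (auto simp: eventually_at_right_field intro!: exI[of _ 1])
  ultimately have "P u + (1 - 0) * (c * (norm (z - u))\<^sup>2) \<le> P z"
    by (rule tendsto_upperbound) simp
  then show ?thesis by (simp add: P_def c_def)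
qed

text \<open>Component \<open>i\<close> enters the subproblem exactly, the others through gradients
  at the points \<open>y j\<close>. For those, the descent lemma relates \<open>u\<close> to
  \<open>y j\<close> and the gradient inequality relates \<open>z\<close> to \<open>y j\<close>.
  Then \<open>f j (y j)\<close> cancels, and the remaining inner products cancel against the linear
  term of the subproblem.\<close>

lemma incremental_aggregated_prox_step:
  fixes f :: "'b \<Rightarrow> 'a::real_inner \<Rightarrow> real"
  assumes J: "finite J" "i \<in> J" and Q: "convex Q" and \<alpha>: "\<alpha> > 0" and z: "z \<in> Q"
    and convex: "\<And>j. j \<in> J \<Longrightarrow> convex_on UNIV (f j)"
    and grad: "\<And>j z. j \<in> J \<Longrightarrow> GDERIV (f j) z :> g j z"
    and lip: "\<And>j y z. j \<in> J \<Longrightarrow> norm (g j y - g j z) \<le> Lip j * norm (y - z)"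
    and min: "is_arg_min (\<lambda>z. f i z + (\<Sum>j\<in>J - {i}. g j (y j)) \<bullet> z
      + 1 / (2 * \<alpha>) * (norm (z - v))\<^sup>2) (\<lambda>z. z \<in> Q) u"
  shows "(\<Sum>j\<in>J. f j u) \<le> (\<Sum>j\<in>J. f j z)
    + ((norm (z - v))\<^sup>2 - (norm (z - u))\<^sup>2 - (norm (u - v))\<^sup>2) / (2 * \<alpha>)
    + (\<Sum>j\<in>J - {i}. Lip j / 2 * (norm (u - y j))\<^sup>2)"
proof -
  define s where "s = (\<Sum>j\<in>J - {i}. g j (y j))"
  have "convex_on UNIV (\<lambda>z. f i z + s \<bullet> z)"
    using convex[OF J(2)]
    by (intro convex_on_add) (auto intro!: convex_onI simp: inner_add_right)
  from prox_three_point[OF this Q \<alpha> z min[folded s_def]]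
  have i: "f i u + s \<bullet> (u - z) \<le> f i z
      + ((norm (z - v))\<^sup>2 - (norm (z - u))\<^sup>2 - (norm (u - v))\<^sup>2) / (2 * \<alpha>)"
    by (simp add: inner_diff_right diff_divide_distrib)
  have "f j u \<le> f j z + g j (y j) \<bullet> (u - z) + Lip j / 2 * (norm (u - y j))\<^sup>2" if "j \<in> J - {i}" for j
    using descent_lemma[of "f j" "g j" "Lip j" u "y j", OF grad lip]
      convex_gradient_inequality[of "f j" "y j" "g j (y j)" z, OF convex grad] that
    by (simp add: inner_diff_right)
  then have "(\<Sum>j\<in>J - {i}. f j u) \<le>
      (\<Sum>j\<in>J - {i}. f j z + g j (y j) \<bullet> (u - z) + Lip j / 2 * (norm (u - y j))\<^sup>2)"
    by (rule sum_mono)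
  also have "\<dots> = (\<Sum>j\<in>J - {i}. f j z) + s \<bullet> (u - z)
      + (\<Sum>j\<in>J - {i}. Lip j / 2 * (norm (u - y j))\<^sup>2)"
    by (simp add: sum.distrib s_def inner_sum_left)
  finally show ?thesis using i by (simp add: sum.remove[OF J])
qed

section \<open>Sums over the delay window\<close>

text \<open>The difference telescopes into \<open>m + 1\<close> steps, since it ends at
  \<open>x (k + 1)\<close>. After the triangle inequality the window is enlarged to
  \<open>\<tau> + 1\<close> steps, and Cauchy-Schwarz gives the factor.\<close>

lemma norm_delayed_difference_le:
  fixes x :: "int \<Rightarrow> 'a::real_normed_vector"
  assumes "m \<le> \<tau>"
  shows "(norm (x (k + 1) - x (k - int m)))\<^sup>2
    \<le> (real \<tau> + 1) * (\<Sum>l\<le>\<tau>. (norm (x (k - int l + 1) - x (k - int l)))\<^sup>2)"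
proof -
  have "x (k + 1) - x (k - int m) = (\<Sum>l\<le>m. x (k - int l + 1) - x (k - int l))"
    by (induction m) (auto simp: algebra_simps)
  then have "(norm (x (k + 1) - x (k - int m)))\<^sup>2 \<le>
      (\<Sum>l\<le>m. norm (x (k - int l + 1) - x (k - int l)))\<^sup>2"
    by (simp add: norm_sum power_mono)
  also have "\<dots> \<le> (\<Sum>l\<le>\<tau>. norm (x (k - int l + 1) - x (k - int l)))\<^sup>2"
    using assms by (intro power_mono sum_mono2 sum_nonneg) auto
  also have "\<dots> \<le> (\<Sum>l\<le>\<tau>. (norm (x (k - int l + 1) - x (k - int l)))\<^sup>2) * card {..\<tau>}"
    by (rule sum_squared_le_sum_of_squares)
  finally show ?thesis by (simp add: algebra_simps)
qed

text \<open>\<open>D (int m)\<close> occurs in the windows of the steps \<open>k = m + l\<close>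
  with \<open>l \<le> \<tau>\<close>, so exchanging the sums collects the weights
  \<open>w (m + l)\<close>. The right side also counts windows of steps from \<open>K\<close>
  on.\<close>

lemma sum_delayed_le:
  fixes D :: "int \<Rightarrow> real" and w :: "nat \<Rightarrow> real"
  assumes D: "\<And>l. 0 \<le> D l" "\<And>l. l < 0 \<Longrightarrow> D l = 0" and w: "\<And>k. 0 \<le> w k"
  shows "(\<Sum>k<K. w k * (\<Sum>l\<le>\<tau>. D (int k - int l))) \<le> (\<Sum>m<K. D (int m) * (\<Sum>l\<le>\<tau>. w (m + l)))"
proof -
  \<comment> \<open>For \<open>k < l\<close> the index of \<open>D\<close> is negative and the term
    vanishes, so the shift by \<open>l\<close> loses nothing.\<close>
  have shift: "(\<Sum>k<l + K. w k * D (int k - int l)) = (\<Sum>m<K. D (int m) * w (m + l))" for l K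
  proof (induction K)
    case 0
    show ?case by (auto intro!: sum.neutral simp: D(2))
  qed (simp add: algebra_simps)
  have "(\<Sum>k<K. w k * (\<Sum>l\<le>\<tau>. D (int k - int l))) = (\<Sum>l\<le>\<tau>. \<Sum>k<K. w k * D (int k - int l))"
    by (simp add: sum_distrib_left sum.swap[of _ "{..<K}"])
  \<comment> \<open>Lengthening each range to \<open>l + K\<close> adds only nonnegative terms and
    makes \<open>shift\<close> applicable.\<close>
  also have "\<dots> \<le> (\<Sum>l\<le>\<tau>. \<Sum>k<l + K. w k * D (int k - int l))"
    by (intro sum_mono sum_mono2) (auto intro!: mult_nonneg_nonneg simp: D w)
  also have "\<dots> = (\<Sum>m<K. D (int m) * (\<Sum>l\<le>\<tau>. w (m + l)))"
    by (simp add: shift sum_distrib_left sum.swap[of _ "{..<K}"])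
  finally show ?thesis .
qed

section \<open>Rates for scalar recursions with delays\<close>

text \<open>Here \<open>a\<close> stands for the gap to the optimal value, \<open>d\<close> for the
  squared distance to a minimizer and \<open>D\<close> for the squared step lengths;
  \<open>step\<close> is the one-step inequality at the minimizer, \<open>descent\<close> the one at
  the current iterate.\<close>

lemma delayed_sublinear_rate:
  fixes a d :: "nat \<Rightarrow> real" and D :: "int \<Rightarrow> real"
  assumes D: "\<And>l. 0 \<le> D l" "\<And>l. l < 0 \<Longrightarrow> D l = 0"
    and d: "\<And>k. 0 \<le> d k" and \<alpha>: "\<alpha> > 0" and L: "L > 0"
    and step: "\<And>k. a (Suc k) \<le> (d k - d (Suc k) - D (int k)) / (2 * \<alpha>)
      + L * (real \<tau> + 1) / 2 * (\<Sum>l\<le>\<tau>. D (int k - int l))"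
    and descent: "\<And>k. k \<ge> 1 \<Longrightarrow> a (Suc k) \<le> a k - D (int k) / \<alpha>
      + L * (real \<tau> + 1) / 2 * (\<Sum>l\<le>\<tau>. D (int k - int l))"
    and \<alpha>_le: "\<alpha> \<le> 2 / (L * (real \<tau> + 1)\<^sup>2 * (real \<tau> + 2))"
  shows "real K * a K \<le> d 0 / (2 * \<alpha>)"
proof -
  define c where "c = L * (real \<tau> + 1) / 2"
  define E where "E k = (\<Sum>l\<le>\<tau>. D (int k - int l))" for k
  \<comment> \<open>The coefficient of \<open>D (int m)\<close> is \<open>1 / (2 * \<alpha>)\<close>
    from \<open>step\<close> plus \<open>m / \<alpha>\<close> from \<open>m\<close> copies of
    \<open>descent\<close>.\<close>
  have ineq: "real K * a K \<le> (d 0 - d K) / (2 * \<alpha>) - (\<Sum>m<K. D (int m) * ((2 * real m + 1) / (2 * \<alpha>)))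
      + c * (\<Sum>k<K. (real k + 1) * E k)" for K
  proof (induction K)
    case (Suc K)
    have "real K * a (Suc K) \<le> real K * (a K - D (int K) / \<alpha> + c * E K)"
      using descent[of K] by (cases "K = 0") (auto intro!: mult_left_mono simp: c_def E_def)
    moreover have "a (Suc K) \<le> (d K - d (Suc K) - D (int K)) / (2 * \<alpha>) + c * E K"
      using step[of K] by (simp add: c_def E_def)
    ultimately have "real (Suc K) * a (Suc K) \<le> real K * a K
        + real K * (c * E K - D (int K) / \<alpha>) + (d K - d (Suc K) - D (int K)) / (2 * \<alpha>) + c * E K"
      by (simp add: algebra_simps)
    also have "\<dots> = real K * a K + (d K - d (Suc K)) / (2 * \<alpha>)
        - D (int K) * ((2 * real K + 1) / (2 * \<alpha>)) + c * ((real K + 1) * E K)"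
      using \<alpha> by (simp add: field_simps)
    finally show ?case using Suc.IH \<alpha> by (simp add: diff_divide_distrib distrib_left)
  qed simp
  have c: "c \<ge> 0" using L by (simp add: c_def)
  have "c * (\<Sum>l\<le>\<tau>. real (m + l) + 1) \<le> (2 * real m + 1) / (2 * \<alpha>)" for m
  proof -
    have "(\<Sum>l\<le>\<tau>. real (m + l) + 1) = (real \<tau> + 1) * (2 * real m + 2 + real \<tau>) / 2"
      by (induction \<tau>) (auto simp: field_simps)
    then have "c * (\<Sum>l\<le>\<tau>. real (m + l) + 1) * (2 * \<alpha>) =
        \<alpha> * (L * (real \<tau> + 1)\<^sup>2) * (2 * real m + 2 + real \<tau>) / 2"
      by (simp add: c_def power2_eq_square)
    \<comment> \<open>The last factors differ by \<open>2 * m * (\<tau> + 1)\<close>. Equality holds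
      for \<open>m = 0\<close>, so the bound on \<open>\<alpha>\<close> is exactly what the
      coefficient of \<open>D 0\<close> requires.\<close>
    also have "\<dots> \<le> \<alpha> * (L * (real \<tau> + 1)\<^sup>2) * ((2 * real m + 1) * (real \<tau> + 2)) / 2"
      using \<alpha> L by (intro divide_right_mono mult_left_mono) (auto simp: algebra_simps)
    also have "\<dots> = \<alpha> * (L * (real \<tau> + 1)\<^sup>2 * (real \<tau> + 2)) * (2 * real m + 1) / 2"
      by simp
    also have "\<dots> \<le> 2 * (2 * real m + 1) / 2"
      using \<alpha>_le L by (intro divide_right_mono mult_right_mono) (auto simp: pos_le_divide_eq)
    finally show ?thesis using \<alpha> by (simp add: pos_le_divide_eq)
  qed
  then have "(\<Sum>m<K. D (int m) * (c * (\<Sum>l\<le>\<tau>. real (m + l) + 1)))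
      \<le> (\<Sum>m<K. D (int m) * ((2 * real m + 1) / (2 * \<alpha>)))"
    by (intro sum_mono mult_left_mono D)
  moreover have "c * (\<Sum>k<K. (real k + 1) * E k) \<le> c * (\<Sum>m<K. D (int m) * (\<Sum>l\<le>\<tau>. real (m + l) + 1))"
    unfolding E_def by (intro mult_left_mono sum_delayed_le D c) auto
  ultimately have "real K * a K \<le> (d 0 - d K) / (2 * \<alpha>)"
    using ineq[of K] by (simp add: sum_distrib_left mult.left_commute)
  also have "\<dots> \<le> d 0 / (2 * \<alpha>)" using d \<alpha> by (intro divide_right_mono) auto
  finally show ?thesis .
qed

lemma delayed_linear_rate:
  fixes G :: "nat \<Rightarrow> real" and D :: "int \<Rightarrow> real"
  assumes D: "\<And>l. 0 \<le> D l" "\<And>l. l < 0 \<Longrightarrow> D l = 0"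
    and \<alpha>: "\<alpha> > 0" and L: "L > 0" and \<nu>: "\<nu> > 0"
    and step: "\<And>k. G (Suc k) \<le> G k / (1 + \<alpha> * \<nu>) - D (int k) / (2 * \<alpha>)
      + L * (real \<tau> + 1) / 2 * (\<Sum>l\<le>\<tau>. D (int k - int l))"
    and \<alpha>_le: "\<alpha> \<le> 1 / \<nu> * ((1 + \<nu> / (L * (real \<tau> + 1))) powr (1 / (real \<tau> + 1)) - 1)"
  shows "G K \<le> (1 / (1 + \<alpha> * \<nu>)) ^ K * G 0"
proof -
  define c where "c = L * (real \<tau> + 1) / 2"
  define E where "E k = (\<Sum>l\<le>\<tau>. D (int k - int l))" for k
  define \<rho> where "\<rho> = 1 + \<alpha> * \<nu>"
  have \<rho>: "\<rho> > 1" using \<alpha> \<nu> by (simp add: \<rho>_def)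
  \<comment> \<open>Multiplying step \<open>k\<close> by \<open>\<rho> ^ Suc k\<close> makes the
    values of \<open>G\<close> telescope; one factor \<open>\<rho>\<close> is pulled out so that the
    weights left are \<open>\<rho> ^ k\<close>.\<close>
  have ineq: "\<rho> ^ K * G K \<le> G 0 + \<rho> * (c * (\<Sum>k<K. \<rho> ^ k * E k)
      - (\<Sum>m<K. D (int m) * (\<rho> ^ m / (2 * \<alpha>))))" for K
  proof (induction K)
    case (Suc K)
    have "\<rho> ^ Suc K * G (Suc K) \<le> \<rho> ^ Suc K * (G K / \<rho> - D (int K) / (2 * \<alpha>) + c * E K)"
      using step[of K] \<rho> by (intro mult_left_mono) (auto simp: \<rho>_def c_def E_def)
    also have "\<dots> = \<rho> ^ K * G K + \<rho> * (c * (\<rho> ^ K * E K) - D (int K) * (\<rho> ^ K / (2 * \<alpha>)))"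
      using \<rho> by (simp add: algebra_simps)
    finally show ?case using Suc.IH by (simp add: algebra_simps)
  qed simp
  have c: "c \<ge> 0" using L by (simp add: c_def)
  \<comment> \<open>The bound on \<open>\<alpha>\<close> puts \<open>\<rho>\<close> below a root of
    order \<open>\<tau> + 1\<close>, which the power \<open>Suc \<tau>\<close> undoes.\<close>
  have "\<rho> \<le> (1 + \<nu> / (L * (real \<tau> + 1))) powr (1 / (real \<tau> + 1))"
    using \<alpha>_le \<nu> by (simp add: \<rho>_def field_simps)
  then have "\<rho> ^ Suc \<tau> \<le> ((1 + \<nu> / (L * (real \<tau> + 1))) powr (1 / (real \<tau> + 1))) ^ Suc \<tau>"
    using \<rho> by (intro power_mono) auto
  also have "\<dots> = 1 + \<nu> / (L * (real \<tau> + 1))"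
  proof -
    have "1 + \<nu> / (L * (real \<tau> + 1)) > 0" using \<nu> L by (intro add_pos_nonneg) auto
    moreover have "1 / (real \<tau> + 1) * real (Suc \<tau>) = 1" by simp
    ultimately show ?thesis by (subst powr_realpow[symmetric]) (simp_all only: powr_powr powr_one powr_gt_zero)
  qed
  finally have \<rho>_le: "L * (real \<tau> + 1) * (\<rho> ^ Suc \<tau> - 1) \<le> \<nu>"
  proof -
    assume "\<rho> ^ Suc \<tau> \<le> 1 + \<nu> / (L * (real \<tau> + 1))"
    then have "\<rho> ^ Suc \<tau> - 1 \<le> \<nu> / (L * (real \<tau> + 1))" by simp
    then have "(\<rho> ^ Suc \<tau> - 1) * (L * (real \<tau> + 1)) \<le> \<nu>"
      using L by (subst (asm) pos_le_divide_eq) auto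
    then show ?thesis by (simp only: mult_ac)
  qed
  have "c * (\<Sum>l\<le>\<tau>. \<rho> ^ (m + l)) \<le> \<rho> ^ m / (2 * \<alpha>)" for m
  proof -
    \<comment> \<open>As \<open>\<alpha> * \<nu> = \<rho> - 1\<close>, this factor turns the
      geometric sum of the window weights into the quantity bounded in
      \<open>\<rho>_le\<close>.\<close>
    have "\<alpha> * \<nu> * (\<Sum>l\<le>\<tau>. \<rho> ^ l) = \<rho> ^ Suc \<tau> - 1"
      using power_diff_1_eq[of \<rho> "Suc \<tau>"] by (simp only: \<rho>_def lessThan_Suc_atMost) simp
    then have "\<nu> * (2 * \<alpha> * c * (\<Sum>l\<le>\<tau>. \<rho> ^ l)) = L * (real \<tau> + 1) * (\<rho> ^ Suc \<tau> - 1)"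
      by (simp only: c_def flip: \<open>\<alpha> * \<nu> * _ = _\<close>) simp
    then have "\<nu> * (2 * \<alpha> * c * (\<Sum>l\<le>\<tau>. \<rho> ^ l)) \<le> \<nu> * 1"
      using \<rho>_le by simp
    then have "2 * \<alpha> * c * (\<Sum>l\<le>\<tau>. \<rho> ^ l) \<le> 1" using \<nu> by simp
    then have "\<rho> ^ m * (2 * \<alpha> * c * (\<Sum>l\<le>\<tau>. \<rho> ^ l)) \<le> \<rho> ^ m * 1"
      using \<rho> by (intro mult_left_mono) auto
    then show ?thesis
      using \<alpha> by (simp add: power_add pos_le_divide_eq flip: sum_distrib_left) (simp add: mult_ac)
  qed
  then have "(\<Sum>m<K. D (int m) * (c * (\<Sum>l\<le>\<tau>. \<rho> ^ (m + l)))) \<le> (\<Sum>m<K. D (int m) * (\<rho> ^ m / (2 * \<alpha>)))"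
    by (intro sum_mono mult_left_mono D)
  moreover have "c * (\<Sum>k<K. \<rho> ^ k * E k) \<le> c * (\<Sum>m<K. D (int m) * (\<Sum>l\<le>\<tau>. \<rho> ^ (m + l)))"
    unfolding E_def using \<rho> by (intro mult_left_mono sum_delayed_le D c) auto
  ultimately have "c * (\<Sum>k<K. \<rho> ^ k * E k) - (\<Sum>m<K. D (int m) * (\<rho> ^ m / (2 * \<alpha>))) \<le> 0"
    by (simp add: sum_distrib_left mult.left_commute)
  then have "\<rho> * (c * (\<Sum>k<K. \<rho> ^ k * E k) - (\<Sum>m<K. D (int m) * (\<rho> ^ m / (2 * \<alpha>)))) \<le> 0"
    using \<rho> by (intro mult_nonneg_nonpos) auto
  then have "\<rho> ^ K * G K \<le> G 0" using ineq[of K] by linarith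
  then show ?thesis using \<rho> by (simp add: \<rho>_def[symmetric] power_one_over field_simps)
qed

section \<open>Lipschitz constant of the delayed part and optimal value\<close>

text \<open>\<open>Max\<close> is informative only on finite sets; the sum depends on
  \<open>k\<close> only through \<open>i k\<close>, which takes at most \<open>N\<close>
  values.\<close>

lemma max_partial_lipschitz_ge:
  assumes "\<And>k. i k \<in> {1..N}"
  shows "(\<Sum>j\<in>{1..N} - {i k}. Lip j) \<le> max_partial_lipschitz N Lip i"
proof -
  have "range (\<lambda>k. \<Sum>j\<in>{1..N} - {i k}. Lip j) \<subseteq> (\<lambda>m. \<Sum>j\<in>{1..N} - {m}. Lip j) ` {1..N}"
    using assms by auto
  then have "finite (range (\<lambda>k. \<Sum>j\<in>{1..N} - {i k}. Lip j))"
    by (rule finite_subset) simp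
  then show ?thesis unfolding max_partial_lipschitz_def by (intro Max_ge) auto
qed

lemma minimizers_opt_val:
  assumes "z \<in> minimizers F Q"
  shows "z \<in> Q" "opt_val F Q = F z"
proof -
  have z: "z \<in> Q" "\<And>y. y \<in> Q \<Longrightarrow> F z \<le> F y"
    using assms by (auto simp: minimizers_def is_arg_min_linorder)
  then show "z \<in> Q" "opt_val F Q = F z"
    unfolding opt_val_def by (auto intro!: cInf_eq_minimum)
qed

theorem corollary4p2:
  fixes Q :: "(real ^ 'd) set"
    and N :: nat
    and f :: "nat \<Rightarrow> real ^ 'd \<Rightarrow> real"
    and g :: "nat \<Rightarrow> real ^ 'd \<Rightarrow> real ^ 'd"
    and Lip :: "nat \<Rightarrow> real"
    and F :: "real ^ 'd \<Rightarrow> real"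
    and Fstar :: real
    and X :: "(real ^ 'd) set"
    and \<alpha> :: real
    and i :: "nat \<Rightarrow> nat"
    and dl :: "nat \<Rightarrow> nat \<Rightarrow> nat"
    and \<tau> :: nat
    and L :: real
    and x :: "int \<Rightarrow> real ^ 'd"
  assumes Q: "Q \<noteq> {}" "closed Q" "convex Q" "interior Q \<noteq> {}"
    and N: "N \<ge> 2"
    and F: "F = obj_sum N f"
    and Fstar: "Fstar = opt_val F Q"
    and X: "X = minimizers F Q" "X \<noteq> {}" "compact X"
    and f_convex: "\<And>n. n \<in> {1..N} \<Longrightarrow> convex_on UNIV (f n)"
    and f_grad: "\<And>n z. n \<in> {1..N} \<Longrightarrow> GDERIV (f n) z :> g n z"
    and Lip_pos: "\<And>n. n \<in> {1..N} \<Longrightarrow> Lip n > 0"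
    and g_Lipschitz: "\<And>n y z. n \<in> {1..N} \<Longrightarrow> norm (g n y - g n z) \<le> Lip n * norm (y - z)"
    and \<alpha>: "\<alpha> > 0"
    and i: "\<And>k. i k \<in> {1..N}"
    and \<tau>: "smallest_delay_bound N dl \<tau>"
    and L: "L = max_partial_lipschitz N Lip i"
    and x: "iap_sequence N f g Q \<alpha> i dl x"
  shows
    "(\<alpha> \<le> 2 / (L * (real \<tau> + 1)\<^sup>2 * (real \<tau> + 2)) \<longrightarrow>
       (\<forall>k::nat. k \<ge> 1 \<longrightarrow> (\<forall>xstar\<in>X.
          F (x (int k)) - Fstar \<le> 1 / (2 * \<alpha> * real k) * (norm (xstar - x 0))\<^sup>2)))
     \<and>
     (\<forall>\<nu>>0. (\<forall>z\<in>Q. F z - Fstar \<ge> \<nu> / 2 * (infdist z X)\<^sup>2) \<longrightarrow>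
       \<alpha> \<le> 1 / \<nu> * ((1 + \<nu> / (L * (real \<tau> + 1))) powr (1 / (real \<tau> + 1)) - 1) \<longrightarrow>
       (\<forall>k::nat. lyapunov F Q \<alpha> (x (int k))
                   \<le> ereal ((1 / (1 + \<alpha> * \<nu>)) ^ k) * lyapunov F Q \<alpha> (x 0)))"
proof -

  \<comment> \<open>The one-step inequality along the iterates\<close>
  define D where "D l = (norm (x (l + 1) - x l))\<^sup>2" for l
  define E where "E k = (\<Sum>l\<le>\<tau>. D (int k - int l))" for k
  have past: "x l = x 0" if "l \<le> 0" for l
    using x that unfolding iap_sequence_def by (cases "l = 0") (blast, force)
  \<comment> \<open>Even the step with index -1, which ends at \<open>x 0\<close>, has length
    0.\<close>
  have D_neg: "D l = 0" if "l < 0" for l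
    using past[of l] past[of "l + 1"] that by (simp add: D_def)
  have min: "is_arg_min (\<lambda>z. f (i k) z
      + (\<Sum>j\<in>{1..N} - {i k}. g j (x (int k - int (dl k j)))) \<bullet> z
      + 1 / (2 * \<alpha>) * (norm (z - x (int k)))\<^sup>2) (\<lambda>z. z \<in> Q) (x (int k + 1))" for k
    using x unfolding iap_sequence_def by blast
  \<comment> \<open>Only from index 1 on: \<open>x 0\<close> is arbitrary, whereas each later
    iterate solves a subproblem over \<open>Q\<close>.\<close>
  have in_Q: "x (int k) \<in> Q" if "k \<ge> 1" for k
    using min[of "k - 1"] that by (simp add: is_arg_min_def of_nat_diff)
  have "L > 0"
  proof -
    \<comment> \<open>Two components leave at least one besides \<open>i 0\<close>, so
      \<open>L\<close> dominates a positive sum.\<close>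
    have "{1..N} - {i 0} \<noteq> {}"
    proof (cases "i 0 = 1")
      case True
      then have "2 \<in> {1..N} - {i 0}" using N by simp
      then show ?thesis by blast
    next
      case False
      then have "1 \<in> {1..N} - {i 0}" using N by simp
      then show ?thesis by blast
    qed
    then have "(\<Sum>j\<in>{1..N} - {i 0}. Lip j) > 0"
      by (intro sum_pos) (auto intro!: Lip_pos)
    then show ?thesis using max_partial_lipschitz_ge[of i N Lip 0, OF i] L by simp
  qed
  have delay: "(\<Sum>j\<in>{1..N} - {i k}. Lip j / 2 * (norm (x (int k + 1) - x (int k - int (dl k j))))\<^sup>2)
      \<le> L * (real \<tau> + 1) / 2 * E k" for k
  proof -
    have "E k \<ge> 0" by (auto simp: E_def D_def intro!: sum_nonneg)
    have "(\<Sum>j\<in>{1..N} - {i k}. Lip j / 2 * (norm (x (int k + 1) - x (int k - int (dl k j))))\<^sup>2)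
      \<le> (\<Sum>j\<in>{1..N} - {i k}. Lip j / 2 * ((real \<tau> + 1) * E k))"
    proof (intro sum_mono mult_left_mono)
      fix j assume j: "j \<in> {1..N} - {i k}"
      then have "dl k j \<le> \<tau>" using \<tau> by (simp add: smallest_delay_bound_def)
      then show "(norm (x (int k + 1) - x (int k - int (dl k j))))\<^sup>2 \<le> (real \<tau> + 1) * E k"
        unfolding E_def D_def by (rule norm_delayed_difference_le)
      show "0 \<le> Lip j / 2" using Lip_pos[of j] j by simp
    qed
    also have "\<dots> = (\<Sum>j\<in>{1..N} - {i k}. Lip j) * ((real \<tau> + 1) * E k / 2)"
      by (simp add: sum_distrib_right)
    also have "\<dots> \<le> L * ((real \<tau> + 1) * E k / 2)"
      using max_partial_lipschitz_ge[of i N Lip k, OF i] L \<open>E k \<ge> 0\<close> by (intro mult_right_mono) auto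
    finally show ?thesis by simp
  qed
  have step: "F (x (int k + 1)) \<le> F z
      + ((norm (z - x (int k)))\<^sup>2 - (norm (z - x (int k + 1)))\<^sup>2 - D (int k)) / (2 * \<alpha>)
      + L * (real \<tau> + 1) / 2 * E k" if "z \<in> Q" for z k
    using incremental_aggregated_prox_step[OF _ i Q(3) \<alpha> that f_convex f_grad g_Lipschitz min[of k]]
      delay[of k]
    unfolding F obj_sum_def D_def by fastforce
  have X_Q: "z \<in> Q" and F_X: "F z = Fstar" if "z \<in> X" for z
    using minimizers_opt_val[of z F Q] that X(1) Fstar by auto
  show ?thesis
  proof (intro conjI impI allI ballI)

    \<comment> \<open>Sublinear rate\<close>
    fix k :: nat and xstar
    assume \<alpha>_le: "\<alpha> \<le> 2 / (L * (real \<tau> + 1)\<^sup>2 * (real \<tau> + 2))" and k: "k \<ge> 1" and xstar: "xstar \<in> X"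
    have "real k * (F (x (int k)) - Fstar) \<le> (norm (xstar - x (int 0)))\<^sup>2 / (2 * \<alpha>)"
    proof (rule delayed_sublinear_rate[of D "\<lambda>k. (norm (xstar - x (int k)))\<^sup>2" \<alpha> L
          "\<lambda>k. F (x (int k)) - Fstar" \<tau>, OF _ D_neg _ \<alpha> \<open>L > 0\<close> _ _ \<alpha>_le])
      fix k
      show "F (x (int (Suc k))) - Fstar \<le> ((norm (xstar - x (int k)))\<^sup>2
          - (norm (xstar - x (int (Suc k))))\<^sup>2 - D (int k)) / (2 * \<alpha>)
          + L * (real \<tau> + 1) / 2 * (\<Sum>l\<le>\<tau>. D (int k - int l))"
        using step[OF X_Q[OF xstar], of k] F_X[OF xstar] by (simp add: E_def add.commute)
      assume "k \<ge> 1"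
      \<comment> \<open>For \<open>z\<close> the current iterate, the first squared distance in
        \<open>step\<close> is 0 and the second is \<open>D (int k)\<close>, so
        \<open>D (int k)\<close> is subtracted twice.\<close>
      have "(0 - D (int k) - D (int k)) / (2 * \<alpha>) = - (D (int k) / \<alpha>)"
        using \<alpha> by (simp add: field_simps)
      then show "F (x (int (Suc k))) - Fstar \<le> F (x (int k)) - Fstar - D (int k) / \<alpha>
          + L * (real \<tau> + 1) / 2 * (\<Sum>l\<le>\<tau>. D (int k - int l))"
        using step[OF in_Q[OF \<open>k \<ge> 1\<close>], of k]
        by (simp add: E_def D_def add.commute norm_minus_commute)
    qed (auto simp: D_def)
    then show "F (x (int k)) - Fstar \<le> 1 / (2 * \<alpha> * real k) * (norm (xstar - x 0))\<^sup>2"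
      using k \<alpha> by (simp add: field_simps)
  next

    \<comment> \<open>Linear rate\<close>
    fix \<nu> :: real and k :: nat
    assume \<nu>: "\<nu> > 0" and growth: "\<forall>z\<in>Q. F z - Fstar \<ge> \<nu> / 2 * (infdist z X)\<^sup>2"
      and \<alpha>_le: "\<alpha> \<le> 1 / \<nu> * ((1 + \<nu> / (L * (real \<tau> + 1))) powr (1 / (real \<tau> + 1)) - 1)"
    define G where "G k = F (x (int k)) - Fstar + 1 / (2 * \<alpha>) * (infdist (x (int k)) X)\<^sup>2" for k
    have lyap: "lyapunov F Q \<alpha> (x (int k)) = ereal (G k)" if "x (int k) \<in> Q" for k
      using that by (simp add: lyapunov_def ext_indicator_def G_def Fstar X(1))
    have pos: "1 + \<alpha> * \<nu> > 0"
      using \<alpha> \<nu> by (intro add_pos_pos) auto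
    show "lyapunov F Q \<alpha> (x (int k)) \<le> ereal ((1 / (1 + \<alpha> * \<nu>)) ^ k) * lyapunov F Q \<alpha> (x 0)"
    proof (cases "x 0 \<in> Q")
      case False
      \<comment> \<open>An infeasible start makes the right side a positive multiple of
        infinity.\<close>
      then have "lyapunov F Q \<alpha> (x 0) = \<infinity>"
        by (simp add: lyapunov_def ext_indicator_def)
      then show ?thesis using pos by simp
    next
      case True
      then have x_Q: "x (int k) \<in> Q" for k
        using in_Q[of k] by (cases "k = 0") auto
      have "G k \<le> (1 / (1 + \<alpha> * \<nu>)) ^ k * G 0"
      proof (rule delayed_linear_rate[of D \<alpha> L \<nu> G \<tau>, OF _ D_neg \<alpha> \<open>L > 0\<close> \<nu> _ \<alpha>_le])
        fix k
        \<comment> \<open>The nearest point to the current iterate realizes its distance to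
          \<open>X\<close> exactly and bounds the next distance from above, which is the direction
          needed.\<close>
        obtain z where z: "z \<in> X" "infdist (x (int k)) X = dist (x (int k)) z"
          using infdist_attains_inf[of X "x (int k)"] X compact_imp_closed by metis
        have "infdist (x (int k + 1)) X \<le> norm (z - x (int k + 1))"
          using infdist_le[OF z(1)] by (metis dist_commute dist_norm)
        then have "(infdist (x (int k + 1)) X)\<^sup>2 \<le> (norm (z - x (int k + 1)))\<^sup>2"
          by (intro power_mono infdist_nonneg)
        moreover have "(infdist (x (int k)) X)\<^sup>2 = (norm (z - x (int k)))\<^sup>2"
          using z(2) by (simp add: dist_norm norm_minus_commute)
        ultimately have "((norm (z - x (int k)))\<^sup>2 - (norm (z - x (int k + 1)))\<^sup>2 - D (int k)) / (2 * \<alpha>)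
            \<le> ((infdist (x (int k)) X)\<^sup>2 - (infdist (x (int k + 1)) X)\<^sup>2 - D (int k)) / (2 * \<alpha>)"
          using \<alpha> by (intro divide_right_mono) auto
        then have "G (Suc k) \<le> (infdist (x (int k)) X)\<^sup>2 / (2 * \<alpha>) - D (int k) / (2 * \<alpha>)
            + L * (real \<tau> + 1) / 2 * E k"
          using step[OF X_Q[OF z(1)], of k] F_X[OF z(1)]
          by (simp add: G_def diff_divide_distrib add.commute)
        \<comment> \<open>Growth bounds the gap inside \<open>G k\<close> below by
          \<open>\<alpha> * \<nu>\<close> times its distance term. It applies at every
          \<open>k\<close>, including 0, because this case assumes \<open>x 0\<close>
          feasible.\<close>
        moreover have "(infdist (x (int k)) X)\<^sup>2 / (2 * \<alpha>) \<le> G k / (1 + \<alpha> * \<nu>)"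
        proof -
          have "(infdist (x (int k)) X)\<^sup>2 / (2 * \<alpha>) * (1 + \<alpha> * \<nu>)
              = (infdist (x (int k)) X)\<^sup>2 / (2 * \<alpha>) + \<nu> / 2 * (infdist (x (int k)) X)\<^sup>2"
            using \<alpha> by (simp add: field_simps)
          also have "\<dots> \<le> G k"
            using growth x_Q[of k] by (simp add: G_def)
          finally have "(infdist (x (int k)) X)\<^sup>2 / (2 * \<alpha>) * (1 + \<alpha> * \<nu>) \<le> G k" .
          then show ?thesis using \<alpha> \<nu> by (simp add: pos_le_divide_eq add_pos_pos)
        qed
        ultimately show "G (Suc k) \<le> G k / (1 + \<alpha> * \<nu>) - D (int k) / (2 * \<alpha>)
            + L * (real \<tau> + 1) / 2 * (\<Sum>l\<le>\<tau>. D (int k - int l))"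
          by (simp add: E_def)
      qed (auto simp: D_def)
      then show ?thesis using lyap[OF x_Q] lyap[of 0] True by simp
    qed
  qed
qed

end
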